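(* Let $L = u_1u_2\ldots u_d$ be a cyclic unimodular sequence of vectors in $\mathbb{Z}^2$, with indices read modulo $d$ (so $u_0 = u_d$, $u_{d+1}=u_1$). Then the rotation number of $L$ is $$Rot(L) = \frac{1}{12}\mu(L) + \frac{1}{4}\nu(L) = \frac{1}{12}\sum_{i=1}^d \mu(u_{i-1},u_i,u_{i+1}) + \frac{1}{4}\sum_{i=1}^d \nu(u_i,u_{i+1}),$$ where $\nu(u_i,u_{i+1}) := \det(u_i,u_{i+1})\in\{-1,+1\}$ and $\mu(u_{i-1},u_i,u_{i+1}) = a_i\in\mathbb{Z}$ is the integer determined by the equation $$\det(u_{i-1},u_i)\,u_{i-1} + \det(u_i,u_{i+1})\,u_{i+1} + a_i u_i = 0.$$
   Context: A finite sequence $L = u_1u_2\ldots u_d$ of vectors in $\mathbb{Z}^2$ is unimodular if $\det(u_i,u_{i+1})\in\{-1,+1\}$ for $i=1,\ldots,d-1$ (equivalently, each $\{u_i,u_{i+1}\}$ is a basis of $\mathbb{Z}^2$). It is cyclic unimodular if in addition $\det(u_d,u_1)\in\{-1,+1\}$; indices are then read modulo $d$. The vectors need not be distinct. The rotation number of a cyclic unimodular sequence is the winding number about the origin $O$ of the closed oriented polygonal curve with vertices $u_1,\ldots,u_d$ and oriented edges $[u_i,u_{i+1}]$ (with $u_{d+1}=u_1$), i.e. $$Rot(L) = \frac{1}{2\pi}\sum_{i=1}^d \nu(u_i,u_{i+1})\,\angle(u_iOu_{i+1}),$$ where $\nu(u_i,u_{i+1})$ is the sign of $\det(u_i,u_{i+1})$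 (here equal to the determinant itself) and $\angle(u_iOu_{i+1})\in(0,\pi)$ is the measure of the (unoriented) angle between $u_i$ and $u_{i+1}$. *)

theory Defs
  imports "HOL-Complex_Analysis.Complex_Analysis"
begin

definition det2 :: "int^2 \<Rightarrow> int^2 \<Rightarrow> int" where
  "det2 u v = det (vector [u, v])"

text \<open>
  A sequence \<open>u\<^sub>1 \<dots> u\<^sub>d\<close> is a list of length \<open>d\<close>. The function \<open>vertex L\<close> is its 1-based
  indexing, read modulo \<open>d\<close>: for a nonempty list, \<open>vertex L 1\<close> is the head of the list,
  \<open>vertex L 0 = vertex L d\<close> and \<open>vertex L (d + 1) = vertex L 1\<close>. The summand \<open>length L\<close> only
  prevents truncation of the subtraction at \<open>i = 0\<close>.
\<close>

definition vertex :: "(int^2) list \<Rightarrow> nat \<Rightarrow> int^2" where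
  "vertex L i = L ! ((i + length L - 1) mod length L)"

definition unimodular :: "(int^2) list \<Rightarrow> bool" where
  "unimodular L \<longleftrightarrow> (\<forall>i\<in>{1..<length L}. det2 (vertex L i) (vertex L (i + 1)) \<in> {-1, 1})"

definition cyclic_unimodular :: "(int^2) list \<Rightarrow> bool" where
  "cyclic_unimodular L \<longleftrightarrow>
     L \<noteq> [] \<and> unimodular L \<and> det2 (vertex L (length L)) (vertex L 1) \<in> {-1, 1}"

definition nu :: "int^2 \<Rightarrow> int^2 \<Rightarrow> int" where
  "nu u v = det2 u v"

definition mu :: "int^2 \<Rightarrow> int^2 \<Rightarrow> int^2 \<Rightarrow> int" where
  "mu u v w = (THE a. det2 u v *s u + det2 v w *s w + a *s v = 0)"

definition nu_seq :: "(int^2) list \<Rightarrow> int" where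
  "nu_seq L = (\<Sum>i=1..length L. nu (vertex L i) (vertex L (i + 1)))"

definition mu_seq :: "(int^2) list \<Rightarrow> int" where
  "mu_seq L = (\<Sum>i=1..length L. mu (vertex L (i - 1)) (vertex L i) (vertex L (i + 1)))"

definition real_vec :: "int^2 \<Rightarrow> real^2" where
  "real_vec u = (\<chi> i. real_of_int (u $ i))"

definition vec_angle :: "real^2 \<Rightarrow> real^2 \<Rightarrow> real" where
  "vec_angle x y = arccos (x \<bullet> y / (norm x * norm y))"

definition Rot :: "(int^2) list \<Rightarrow> real" where
  "Rot L = 1 / (2 * pi) *
     (\<Sum>i=1..length L. real_of_int (sgn (det2 (vertex L i) (vertex L (i + 1))))
        * vec_angle (real_vec (vertex L i)) (real_vec (vertex L (i + 1))))"


subsection \<open>The integer defining \<open>mu\<close> exists and is unique\<close>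

lemma det2_eq: "det2 u v = u $ 1 * v $ 2 - u $ 2 * v $ 1"
  by (simp add: det2_def det_2)

lemma mu_ex1:
  assumes "det2 u v \<in> {-1, 1}" "det2 v w \<in> {-1, 1}"
  shows "\<exists>!a. det2 u v *s u + det2 v w *s w + a *s v = 0"
proof
  define e f where "e = det2 u v" and "f = det2 v w"
  define a where "a = - (e * f * det2 u w)"
  have ef: "e * e = 1" "f * f = 1"
    using assms by (auto simp: e_def f_def)
  have e: "e = u $ 1 * v $ 2 - u $ 2 * v $ 1" and f: "f = v $ 1 * w $ 2 - v $ 2 * w $ 1"
    by (simp_all add: e_def f_def det2_eq)
  have "e * u $ i + f * w $ i + a * v $ i = 0" if "i = 1 \<or> i = 2" for i :: 2
  proof -
    have plucker: "det2 u w * v $ i = f * u $ i + e * w $ i"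
      using that unfolding e f det2_eq by (auto simp: algebra_simps)
    have "a * v $ i = - (e * f * (det2 u w * v $ i))"
      by (simp add: a_def)
    also have "\<dots> = - (e * (f * f) * u $ i + (e * e) * f * w $ i)"
      by (simp add: plucker algebra_simps)
    finally show ?thesis by (simp add: ef)
  qed
  then show "det2 u v *s u + det2 v w *s w + a *s v = 0"
    by (simp add: vec_eq_iff forall_2 flip: e_def f_def)
  fix b
  assume b: "det2 u v *s u + det2 v w *s w + b *s v = 0"
  have "v \<noteq> 0" using assms by (auto simp: det2_eq)
  then obtain i where "v $ i \<noteq> 0" by (auto simp: vec_eq_iff)
  moreover have "e * u $ i + f * w $ i + b * v $ i = 0"
    using arg_cong[OF b, of "\<lambda>x. x $ i"] by (simp add: e_def f_def)
  moreover have "e * u $ i + f * w $ i + a * v $ i = 0"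
    using \<open>det2 u v *s u + det2 v w *s w + a *s v = 0\<close>
    by (simp add: vec_eq_iff e_def f_def)
  ultimately show "b = a"
    by (metis add_left_cancel mult_right_cancel)
qed


subsection \<open>\<open>Rot\<close> is the winding number of the closed polygonal curve about the origin\<close>

fun polygonal_path :: "complex list \<Rightarrow> real \<Rightarrow> complex" where
  "polygonal_path (a # b # c # zs) = linepath a b +++ polygonal_path (b # c # zs)"
| "polygonal_path [a, b] = linepath a b"
| "polygonal_path [a] = linepath a a"
| "polygonal_path [] = linepath 0 0"

definition to_complex :: "int^2 \<Rightarrow> complex" where
  "to_complex u = Complex (real_of_int (u $ 1)) (real_of_int (u $ 2))"

lemma Re_winding_number_linepath_0:
  assumes "Im (cnj a * b) \<noteq> 0"
  shows "0 \<notin> closed_segment a b"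
    and "Re (winding_number (linepath a b) 0)
      = sgn (Im (cnj a * b)) * arccos (Re (cnj a * b) / (cmod a * cmod b)) / (2 * pi)"
proof -
  have nz: "a \<noteq> 0" "b \<noteq> 0" using assms by auto
  have seg: "z / a \<notin> \<real>\<^sub>\<le>\<^sub>0" if "z \<in> closed_segment a b" for z
  proof -
    obtain t where t: "0 \<le> t" "t \<le> 1" "z = (1 - t) *\<^sub>R a + t *\<^sub>R b"
      using \<open>z \<in> closed_segment a b\<close> by (auto simp: closed_segment_def)
    have eq: "z / a = of_real (1 - t) + of_real t * (b / a)"
      using nz by (simp add: t scaleR_conv_of_real field_simps)
    have "Im (b / a) \<noteq> 0"
      using assms nz by (auto simp: Im_divide algebra_simps)
    moreover have "Im (z / a) = t * Im (b / a)" "Re (z / a) = (1 - t) + t * Re (b / a)"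
      unfolding eq by (simp_all del: times_divide_eq_right)
    ultimately show ?thesis
      by (cases "t = 0") (simp_all add: complex_nonpos_Reals_iff)
  qed
  show 0: "0 \<notin> closed_segment a b" using seg by fastforce
  have "((\<lambda>z. 1 / z) has_contour_integral
          (Ln (pathfinish (linepath a b) / a) - Ln (pathstart (linepath a b) / a))) (linepath a b)"
  proof (rule contour_integral_primitive[where S = "closed_segment a b"])
    fix z assume z: "z \<in> closed_segment a b"
    then have "z \<noteq> 0" using 0 by auto
    then show "((\<lambda>z. Ln (z / a)) has_field_derivative 1 / z) (at z within closed_segment a b)"
      using seg[OF z] nz by (auto intro!: derivative_eq_intros simp: field_simps)
  qed auto
  then have "contour_integral (linepath a b) (\<lambda>z. 1 / z) = Ln (b / a)"
    using nz by (simp add: contour_integral_unique)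
  then have re: "Re (winding_number (linepath a b) 0) = Arg (b / a) / (2 * pi)"
    using 0 nz by (simp add: Re_winding_number Arg_eq_Im_Ln)
  have ba: "b / a = cnj a * b / of_real ((cmod a)\<^sup>2)"
    using nz by (simp add: complex_norm_square field_simps del: of_real_power)
  have sg: "sgn (Im (b / a)) = sgn (Im (cnj a * b))"
    unfolding ba Im_divide_of_real using nz by (simp add: sgn_divide)
  have "cos (Arg (b / a)) = Re (b / a) / cmod (b / a)"
    using nz by (simp add: cos_Arg)
  also have "\<dots> = Re (cnj a * b) / (cmod a * cmod b)"
    unfolding ba Re_divide_of_real using nz
    by (simp add: norm_divide norm_mult power2_eq_square field_simps)
  finally have "Re (cnj a * b) / (cmod a * cmod b) = cos (Arg (b / a))" by simp
  moreover have "Arg (b / a) = sgn (Im (cnj a * b)) * arccos (cos (Arg (b / a)))"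
  proof (cases "Im (b / a) > 0")
    case True
    then have "0 < Arg (b / a)" "Arg (b / a) < pi" using Arg_lt_pi by auto
    moreover have "sgn (Im (cnj a * b)) = 1"
      unfolding sg[symmetric] using True by (rule sgn_pos)
    ultimately show ?thesis
      by (simp add: arccos_cos del: times_complex.sel cnj.sel)
  next
    case False
    then have "Im (b / a) < 0"
      using assms sg by (metis linorder_neqE_linordered_idom sgn_0_0)
    then have "Arg (b / a) < 0" "- pi < Arg (b / a)"
      using Arg_neg_iff mpi_less_Arg by auto
    moreover have "sgn (Im (cnj a * b)) = -1"
      unfolding sg[symmetric] using \<open>Im (b / a) < 0\<close> by (rule sgn_neg)
    ultimately show ?thesis
      by (simp add: arccos_cos2 del: times_complex.sel cnj.sel)
  qed
  ultimately show "Re (winding_number (linepath a b) 0)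
      = sgn (Im (cnj a * b)) * arccos (Re (cnj a * b) / (cmod a * cmod b)) / (2 * pi)"
    using re by simp
qed

lemma polygonal_path_props:
  assumes "length zs \<ge> 2"
    and "\<And>i. Suc i < length zs \<Longrightarrow> 0 \<notin> closed_segment (zs ! i) (zs ! Suc i)"
  shows "path (polygonal_path zs) \<and> pathstart (polygonal_path zs) = hd zs
    \<and> pathfinish (polygonal_path zs) = last zs \<and> 0 \<notin> path_image (polygonal_path zs)
    \<and> winding_number (polygonal_path zs) 0
        = (\<Sum>i<length zs - 1. winding_number (linepath (zs ! i) (zs ! Suc i)) 0)"
  using assms
proof (induction zs rule: polygonal_path.induct)
  case (1 a b c zs)
  let ?p = "polygonal_path (b # c # zs)"
  have seg: "0 \<notin> closed_segment a b" using "1.prems"(2)[of 0] by simp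
  have "0 \<notin> closed_segment ((b # c # zs) ! i) ((b # c # zs) ! Suc i)"
    if "Suc i < length (b # c # zs)" for i
    using "1.prems"(2)[of "Suc i"] that by simp
  from "1.IH"[OF _ this] have IH: "path ?p" "pathstart ?p = b" "pathfinish ?p = last (c # zs)"
    "0 \<notin> path_image ?p"
    "winding_number ?p 0 = (\<Sum>i<Suc (length zs).
       winding_number (linepath ((b # c # zs) ! i) ((b # c # zs) ! Suc i)) 0)"
    by auto
  have "winding_number (linepath a b +++ ?p) 0
      = winding_number (linepath a b) 0 + winding_number ?p 0"
    using IH seg by (intro winding_number_join) auto
  also have "\<dots> = (\<Sum>i<Suc (Suc (length zs)).
       winding_number (linepath ((a # b # c # zs) ! i) ((a # b # c # zs) ! Suc i)) 0)"
    by (subst sum.lessThan_Suc_shift) (simp add: IH(5))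
  finally show ?case
    using IH seg by (simp add: path_image_join)
qed auto

lemma vec_angle_to_complex:
  "vec_angle (real_vec u) (real_vec v)
     = arccos (Re (cnj (to_complex u) * to_complex v) / (cmod (to_complex u) * cmod (to_complex v)))"
  by (simp add: vec_angle_def real_vec_def to_complex_def inner_vec_def sum_2 norm_vec_def
      L2_set_def cmod_def)

lemma det2_to_complex: "real_of_int (det2 u v) = Im (cnj (to_complex u) * to_complex v)"
  by (simp add: det2_eq to_complex_def)

lemma winding_number_polygonal_path_eq_Rot:
  assumes "cyclic_unimodular L"
  shows "winding_number (polygonal_path (map to_complex (L @ [hd L]))) 0 = of_real (Rot L)"
proof -
  define d where "d = length L"
  define zs where "zs = map to_complex (L @ [hd L])"
  have d: "d > 0" and len: "length zs = Suc d"
    using assms by (auto simp: cyclic_unimodular_def d_def zs_def)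
  have nth: "zs ! i = to_complex (vertex L (Suc i))" if "i \<le> d" for i
  proof (cases "i = d")
    case True
    then show ?thesis
      using d by (simp add: zs_def vertex_def nth_append d_def hd_conv_nth)
  next
    case False
    then show ?thesis
      using that d by (simp add: zs_def vertex_def nth_append d_def)
  qed
  have wrap: "vertex L (Suc d) = vertex L 1"
    using d by (simp add: vertex_def d_def)
  have det: "det2 (vertex L (Suc i)) (vertex L (Suc (Suc i))) \<in> {-1, 1}" if "i < d" for i
  proof (cases "Suc i = d")
    case True
    then show ?thesis
      using assms wrap by (simp add: cyclic_unimodular_def flip: d_def)
  next
    case False
    then show ?thesis
      using assms that by (auto simp: cyclic_unimodular_def unimodular_def simp flip: d_def)
  qed
  have Im: "Im (cnj (zs ! i) * zs ! Suc i) = det2 (vertex L (Suc i)) (vertex L (Suc (Suc i)))"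
    if "i < d" for i
    using that by (simp add: nth det2_to_complex)
  then have Im0: "Im (cnj (zs ! i) * zs ! Suc i) \<noteq> 0" if "i < d" for i
    using that det[OF that] by (metis insertE of_int_eq_0_iff one_neq_zero neg_equal_0_iff_equal singletonD)
  have props: "path (polygonal_path zs)" "pathstart (polygonal_path zs) = hd zs"
    "pathfinish (polygonal_path zs) = last zs" "0 \<notin> path_image (polygonal_path zs)"
    "winding_number (polygonal_path zs) 0
       = (\<Sum>i<d. winding_number (linepath (zs ! i) (zs ! Suc i)) 0)"
    using polygonal_path_props[of zs] Re_winding_number_linepath_0(1)[OF Im0] len d by auto
  have "hd zs = last zs"
    using d by (cases L) (auto simp: zs_def d_def)
  then have "winding_number (polygonal_path zs) 0 \<in> \<int>"
    using props by (intro integer_winding_number) auto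
  then have "winding_number (polygonal_path zs) 0
      = of_real (Re (winding_number (polygonal_path zs) 0))"
    by (auto elim: Ints_cases)
  also have "Re (winding_number (polygonal_path zs) 0)
      = (\<Sum>i<d. sgn (real_of_int (det2 (vertex L (Suc i)) (vertex L (Suc (Suc i)))))
          * vec_angle (real_vec (vertex L (Suc i))) (real_vec (vertex L (Suc (Suc i)))) / (2 * pi))"
    unfolding props Re_sum
    by (intro sum.cong refl, subst Re_winding_number_linepath_0(2)[OF Im0])
      (simp_all add: nth vec_angle_to_complex det2_to_complex)
  also have "\<dots> = (\<Sum>i=1..d. sgn (real_of_int (det2 (vertex L i) (vertex L (Suc i))))
          * vec_angle (real_vec (vertex L i)) (real_vec (vertex L (Suc i))) / (2 * pi))"
    by (rule sum.reindex_bij_witness[of _ "\<lambda>i. i - 1" Suc]) auto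
  also have "\<dots> = Rot L"
    unfolding Rot_def d_def sum_divide_distrib[symmetric]
    by (auto simp: sgn_if intro!: sum.cong)
  finally show ?thesis by (simp add: zs_def)
qed

end

theory Submission
  imports Defs
begin

text \<open>
  Taking the inner product of the defining equation of \<open>\<mu>(u,v,w)\<close> with \<open>v\<close> gives
  \<open>\<mu>(u,v,w) = - (det(u,v) (u \<cdot> v) + det(v,w) (v \<cdot> w)) / |v|\<^sup>2\<close>, and since
  \<open>|u|\<^sup>2 |v|\<^sup>2 = 1 + (u \<cdot> v)\<^sup>2\<close> for a unimodular pair, its angle is \<open>\<pi>/2 - arctan (u \<cdot> v)\<close>.
  Hence \<open>12 Rot(L) - \<mu>(L) - 3 \<nu>(L)\<close> is a sum of terms \<open>F(u,v)\<close>, one for each edge of \<open>L\<close>.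
  The function \<open>F\<close> is antisymmetric, does not change when \<open>u\<close> or \<open>v\<close> is negated, and sums to zero
  over every triangle \<open>u, v, u + v\<close>. The Farey complex formed by these triangles is simply
  connected, so \<open>F(u,v) = g(v) - g(u)\<close> for a function \<open>g\<close> of one vector, and the sum over the
  closed sequence telescopes. Concretely, \<open>g\<close> is built by recursion on the Euclidean norm: a vector
  with a shorter neighbour in the graph of unimodular pairs takes its value from such a neighbour,
  and any two shorter neighbours are equal up to sign or span a triangle with it.
\<close>

section \<open>Inner products and unimodular pairs\<close>

definition idot :: "int^2 \<Rightarrow> int^2 \<Rightarrow> int" where
  "idot u v = u $ 1 * v $ 1 + u $ 2 * v $ 2"

definition unimodular_pair :: "int^2 \<Rightarrow> int^2 \<Rightarrow> bool" where
  "unimodular_pair u v \<longleftrightarrow> det2 u v = 1 \<or> det2 u v = -1"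

text \<open>This is the \<open>F(u,v)\<close> of the overview. The rational terms collect one half
  of \<open>mu\<close> from each endpoint; the constant part of the angle has cancelled against
  \<open>3 * nu\<close>, which leaves the arctangent.\<close>

definition edge_defect :: "int^2 \<Rightarrow> int^2 \<Rightarrow> real" where
  "edge_defect u v = real_of_int (det2 u v) *
     (real_of_int (idot u v) * (1 / real_of_int (idot u u) + 1 / real_of_int (idot v v))
       - 6 / pi * arctan (real_of_int (idot u v)))"

lemma idot_commute: "idot u v = idot v u"
  by (simp add: idot_def algebra_simps)

lemma idot_uminus [simp]: "idot (- u) v = - idot u v" "idot u (- v) = - idot u v"
  by (simp_all add: idot_def)

lemma det2_uminus [simp]: "det2 (- u) v = - det2 u v" "det2 u (- v) = - det2 u v"
  by (simp_all add: det2_eq)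

lemma det2_commute: "det2 v u = - det2 u v"
  by (simp add: det2_eq)

lemma idot_self_nonneg: "idot u u \<ge> 0"
  by (simp add: idot_def)

lemma lagrange_identity: "idot u u * idot v v = (det2 u v)\<^sup>2 + (idot u v)\<^sup>2"
  by (simp add: idot_def det2_eq power2_eq_square algebra_simps)

lemma unimodular_pair_commute: "unimodular_pair u v \<longleftrightarrow> unimodular_pair v u"
  by (auto simp: unimodular_pair_def det2_commute[of u v])

lemma unimodular_pair_uminus [simp]:
  "unimodular_pair (- u) v = unimodular_pair u v" "unimodular_pair u (- v) = unimodular_pair u v"
  by (auto simp: unimodular_pair_def)

lemma unimodular_pair_norms:
  assumes "unimodular_pair u v"
  shows "idot u u * idot v v = 1 + (idot u v)\<^sup>2" "idot u u > 0" "idot v v > 0"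
proof -
  show *: "idot u u * idot v v = 1 + (idot u v)\<^sup>2"
    using assms lagrange_identity[of u v] by (auto simp: unimodular_pair_def)
  then have "idot u u * idot v v > 0"
    using zero_le_power2[of "idot u v"] by linarith
  then show "idot u u > 0" "idot v v > 0"
    using idot_self_nonneg[of u] idot_self_nonneg[of v] by (auto simp: zero_less_mult_iff)
qed

text \<open>With common squared length \<open>n\<close> and \<open>s\<close> the absolute inner
  product, \<open>n * n - s * s = 1\<close> factors over the integers. This settles the base case of
  the later induction.\<close>

lemma unimodular_pair_eq_norm:
  assumes "unimodular_pair u v" "idot u u = idot v v"
  shows "idot u u = 1" "idot u v = 0"
proof -
  define n s where "n = idot u u" and "s = \<bar>idot u v\<bar>"
  have n: "n > 0" "n * n = 1 + s * s"
    using unimodular_pair_norms[OF assms(1)] assms(2) by (auto simp: n_def s_def power2_eq_square)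
  then have "(n - s) * (n + s) = 1" by (simp add: algebra_simps)
  moreover have "n + s > 0" using n by (simp add: s_def)
  ultimately have "n + s = 1" "n - s = 1"
    by (auto simp: zmult_eq_1_iff)
  then show "idot u u = 1" "idot u v = 0" by (auto simp: n_def s_def)
qed

subsection \<open>The defect on edges and triangles\<close>

lemma edge_defect_uminus [simp]:
  "edge_defect (- u) v = edge_defect u v" "edge_defect u (- v) = edge_defect u v"
  by (simp_all add: edge_defect_def arctan_minus algebra_simps)

lemma edge_defect_commute: "edge_defect v u = - edge_defect u v"
  by (simp add: edge_defect_def det2_commute[of u v] idot_commute[of u v] add.commute)

text \<open>Additivity of angles when \<open>u + v\<close> is inserted between \<open>u\<close> and
  \<open>v\<close>. It holds because \<open>1 + x * (x + b) = b * (x + a)\<close>, so the difference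
  \<open>t\<close> has cotangent \<open>x + a\<close>.\<close>

lemma arctan_triangle:
  fixes x a b :: real
  assumes "a > 0" "b > 0" "a * b = 1 + x\<^sup>2"
  shows "arctan (x + a) + arctan (x + b) = pi / 2 + arctan x"
proof -
  define t where "t = arctan (x + b) - arctan x"
  have t: "0 < t" "t < pi"
    using assms arctan_less_iff[of x "x + b"] arctan_bounded[of x] arctan_bounded[of "x + b"]
    by (auto simp: t_def)
  have pos: "1 + x\<^sup>2 > 0" "1 + (x + b)\<^sup>2 > 0"
    by (simp_all add: add_pos_nonneg)
  have "sqrt (1 + x\<^sup>2) > 0" "sqrt (1 + (x + b)\<^sup>2) > 0"
    using pos by simp_all
  then have "sin t * (x + a) = cos t"
    using assms(3)
    by (simp add: t_def sin_diff cos_diff sin_arctan cos_arctan field_simps power2_eq_square)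
  \<comment> \<open>The complementary angle is used because \<open>tan t\<close> has no meaning when
    \<open>x + a = 0\<close>, whereas \<open>sin t\<close> is positive.\<close>
  then have "tan (pi / 2 - t) = x + a"
    using sin_gt_zero[OF t] unfolding tan_def sin_diff cos_diff by (simp add: field_simps)
  then have "arctan (x + a) = pi / 2 - t"
    using t by (intro arctan_unique) auto
  then show ?thesis by (simp add: t_def)
qed

text \<open>The rational terms add up to \<open>-3\<close>, and the arctangents to
  \<open>pi / 2\<close>, which the factor \<open>6 / pi\<close> turns into \<open>3\<close>.\<close>

lemma edge_defect_triangle_pos:
  assumes "det2 u v = 1"
  shows "edge_defect u v + edge_defect v (u + v) + edge_defect (u + v) u = 0"
proof -
  define w where "w = u + v"
  have dets: "det2 v w = -1" "det2 w u = -1"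
    using assms by (simp_all add: w_def det2_eq algebra_simps)
  define x a b c :: real
    where "x = idot u v" and "a = idot u u" and "b = idot v v" and "c = idot w w"
  have "unimodular_pair u v" "unimodular_pair v w"
    using assms dets by (auto simp: unimodular_pair_def)
  then have ab: "a > 0" "b > 0" "c > 0" "a * b = 1 + x\<^sup>2"
    using unimodular_pair_norms[of u v] unimodular_pair_norms[of v w]
    by (auto simp: a_def b_def c_def x_def simp flip: of_int_mult of_int_power)
  have c: "c = a + 2 * x + b" and vw: "real_of_int (idot v w) = x + b"
    and wu: "real_of_int (idot w u) = x + a"
    by (simp_all add: a_def b_def c_def x_def w_def idot_def algebra_simps)
  have "x / a + x / b - ((x + b) / b + (x + b) / c) - ((x + a) / c + (x + a) / a)
      = - 2 - (a + 2 * x + b) / c"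
    using ab(1-3) by (simp add: field_simps)
  also have "\<dots> = -3"
    using ab c by simp
  finally have rat: "x / a + x / b - ((x + b) / b + (x + b) / c) - ((x + a) / c + (x + a) / a) = -3" .
  have "edge_defect u v + edge_defect v w + edge_defect w u
      = x / a + x / b - ((x + b) / b + (x + b) / c) - ((x + a) / c + (x + a) / a)
        + 6 / pi * (arctan (x + a) + arctan (x + b) - arctan x)"
    unfolding edge_defect_def assms dets vw wu a_def[symmetric] b_def[symmetric]
      c_def[symmetric] x_def[symmetric]
    by (simp add: algebra_simps add_divide_distrib diff_divide_distrib)
  also have "\<dots> = 0"
    unfolding rat arctan_triangle[OF ab(1,2,4)] by simp
  finally show ?thesis by (simp add: w_def)
qed

lemma edge_defect_triangle:
  assumes "unimodular_pair u v"
  shows "edge_defect u v + edge_defect v (u + v) + edge_defect (u + v) u = 0"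
proof (cases "det2 u v = 1")
  case True
  then show ?thesis by (rule edge_defect_triangle_pos)
next
  case False
  then have "det2 v u = 1"
    using assms by (simp add: unimodular_pair_def det2_commute[of u v])
  from edge_defect_triangle_pos[OF this] show ?thesis
    using edge_defect_commute[of u v] edge_defect_commute[of u "u + v"]
      edge_defect_commute[of v "u + v"] by (simp add: add.commute)
qed

subsection \<open>The potential\<close>

definition shorter_neighbour :: "int^2 \<Rightarrow> int^2 \<Rightarrow> bool" where
  "shorter_neighbour p v \<longleftrightarrow> unimodular_pair p v \<and> idot p p < idot v v"

definition parent :: "int^2 \<Rightarrow> int^2" where
  "parent v = (SOME p. shorter_neighbour p v)"

lemma parent: "shorter_neighbour p v \<Longrightarrow> shorter_neighbour (parent v) v"
  unfolding parent_def by (rule someI)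

lemma shorter_neighbour_uminus [simp]: "shorter_neighbour p (- v) = shorter_neighbour p v"
  by (simp add: shorter_neighbour_def)

text \<open>Both choices are made from the same predicate, hence agree; \<open>potential\<close>
  inherits its evenness from this.\<close>

lemma parent_uminus [simp]: "parent (- v) = parent v"
  by (simp add: parent_def)

function potential :: "int^2 \<Rightarrow> real" where
  "potential v = (if \<exists>p. shorter_neighbour p v
     then potential (parent v) + edge_defect (parent v) v else 0)"
  by auto
termination
proof (relation "Wellfounded.measure (\<lambda>v. nat (idot v v))")
  fix v
  assume "\<exists>p. shorter_neighbour p v"
  then have "shorter_neighbour (parent v) v" by (auto intro: parent)
  then show "(parent v, v) \<in> Wellfounded.measure (\<lambda>v. nat (idot v v))"
    using idot_self_nonneg[of "parent v"] by (simp add: shorter_neighbour_def)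
qed simp

declare potential.simps [simp del]

lemma potential_uminus [simp]: "potential (- v) = potential v"
  by (simp add: potential.simps[of v] potential.simps[of "- v"])

lemma potential_short:
  assumes "idot v v = 1"
  shows "potential v = 0"
proof -
  have "\<not> shorter_neighbour p v" for p
    using assms unimodular_pair_norms[of p v] by (auto simp: shorter_neighbour_def)
  then show ?thesis by (simp add: potential.simps)
qed

text \<open>In the basis \<open>p\<close>, \<open>v\<close> the vector \<open>u\<close> is
  \<open>s *s p + k *s v\<close> with \<open>s\<close> a sign, and the length bounds force
  \<open>k\<close> to be -1, 0 or 1.\<close>

lemma shorter_neighbours_cases:
  assumes "shorter_neighbour u v" "shorter_neighbour p v"
  obtains "u = p \<or> u = - p"
  | p' v' where "p' = p \<or> p' = - p" "v' = v \<or> v' = - v" "u = p' + v'"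
proof -
  \<comment> \<open>Cramer's rule; division by \<open>det2 p v\<close> is multiplication by it,
    since it is a sign.\<close>
  define s k where "s = det2 p v * det2 u v" and "k = det2 p v * det2 p u"
  have un: "unimodular_pair u v" "unimodular_pair p v"
    and less: "idot u u < idot v v" "idot p p < idot v v"
    using assms by (auto simp: shorter_neighbour_def)
  have s: "s = 1 \<or> s = -1" and one: "det2 p v * det2 p v = 1"
    using un by (auto simp: s_def unimodular_pair_def)
  have "det2 p v * u $ i = det2 u v * p $ i + det2 p u * v $ i" for i
    using exhaust_2[of i] by (auto simp: det2_eq algebra_simps)
  then have "det2 p v * (det2 p v * u $ i) = s * p $ i + k * v $ i" for i
    by (simp add: s_def k_def algebra_simps)
  then have u: "u $ i = s * p $ i + k * v $ i" for i
    using one by (simp flip: mult.assoc)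
  \<comment> \<open>The parallelogram law for \<open>u\<close> and \<open>s *s p\<close>, whose
    difference is \<open>k *s v\<close>.\<close>
  have "k\<^sup>2 * idot v v + idot (u + s *s p) (u + s *s p) = 2 * idot u u + 2 * (s * s) * idot p p"
    by (simp add: idot_def u power2_eq_square algebra_simps)
  moreover have "s * s = 1" using s by auto
  ultimately have "k\<^sup>2 * idot v v < 4 * idot v v"
    using less idot_self_nonneg[of "u + s *s p"] by simp
  then have "k\<^sup>2 < 2\<^sup>2"
    using idot_self_nonneg[of v] by (simp add: mult_less_cancel_right)
  then have "\<bar>k\<bar> < 2"
    using power2_less_imp_less[of "\<bar>k\<bar>" 2] by simp
  then consider "k = 0" | "k = 1" | "k = -1" by linarith
  then show thesis
  proof cases
    case 1
    then have "u = p \<or> u = - p" using s u by (auto simp: vec_eq_iff)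
    then show thesis by (rule that(1))
  next
    case 2
    then have "u = s *s p + v" using u by (auto simp: vec_eq_iff)
    moreover have "s *s p = p \<or> s *s p = - p" using s by (auto simp: vec_eq_iff)
    ultimately show thesis using that(2)[of "s *s p" v] by blast
  next
    case 3
    then have "u = s *s p + - v" using u by (auto simp: vec_eq_iff)
    moreover have "s *s p = p \<or> s *s p = - p" using s by (auto simp: vec_eq_iff)
    ultimately show thesis using that(2)[of "s *s p" "- v"] by blast
  qed
qed

text \<open>Induction on the sum of the squared lengths. If \<open>u\<close> is the shorter end and
  \<open>p\<close> the parent of \<open>v\<close>, then either \<open>u\<close> is \<open>p\<close>
  up to sign, or a triangle reduces the claim to the smaller edge from \<open>p\<close> to
  \<open>u\<close>.\<close>

lemma edge_defect_eq_potential_diff: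
  assumes "unimodular_pair u v"
  shows "edge_defect u v = potential v - potential u"
  using assms
proof (induction "nat (idot u u + idot v v)" arbitrary: u v rule: less_induct)
  case less
  \<comment> \<open>Stated for fresh \<open>u\<close> and \<open>v\<close>, so that it serves both
    orientations of the edge.\<close>
  have shorter: "edge_defect u v = potential v - potential u"
    if sh: "shorter_neighbour u v"
      and IH: "\<And>p q. unimodular_pair p q \<Longrightarrow> idot p p < idot v v \<Longrightarrow> idot q q \<le> idot u u
        \<Longrightarrow> edge_defect p q = potential q - potential p" for u v
  proof -
    define p where "p = parent v"
    have p: "shorter_neighbour p v" unfolding p_def using sh by (rule parent)
    have pot: "potential v = potential p + edge_defect p v"
      unfolding p_def using sh by (subst potential.simps) auto
    from sh p show ?thesis
    proof (cases rule: shorter_neighbours_cases)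
      case 1
      then show ?thesis using pot by auto
    next
      case (2 p' v')
      have un: "unimodular_pair p' v'" "unimodular_pair p v" "idot p p < idot v v"
        using p 2 by (auto simp: shorter_neighbour_def)
      have "edge_defect p' v' + edge_defect v' u + edge_defect u p' = 0"
        using edge_defect_triangle[OF un(1)] 2 by simp
      then have tri: "edge_defect p v + edge_defect v u + edge_defect u p = 0"
        using 2 by auto
      \<comment> \<open>Adding \<open>p'\<close> to \<open>v'\<close> leaves the determinant with
        \<open>p'\<close> unchanged, so \<open>p\<close> and \<open>u\<close> form an edge.\<close>
      have "det2 p' u = det2 p' v'"
        by (simp add: 2 det2_eq algebra_simps)
      then have "unimodular_pair p' u"
        using un by (simp add: unimodular_pair_def)
      then have "unimodular_pair p u" using 2 by auto
      then have "edge_defect p u = potential u - potential p"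
        using un by (intro IH) auto
      then show ?thesis
        using tri pot edge_defect_commute[of p u] edge_defect_commute[of u v] by simp
    qed
  qed
  have IH: "edge_defect p q = potential q - potential p"
    if "unimodular_pair p q" "idot p p + idot q q < idot u u + idot v v" for p q
  proof (rule less.hyps)
    show "nat (idot p p + idot q q) < nat (idot u u + idot v v)"
      using that idot_self_nonneg[of p] idot_self_nonneg[of q] by linarith
  qed (rule that)
  consider "idot u u = idot v v" | "idot u u < idot v v" | "idot v v < idot u u" by linarith
  then show ?case
  proof cases
    case 1
    then show ?thesis
      using unimodular_pair_eq_norm[OF less.prems] potential_short
      by (simp add: edge_defect_def)
  next
    case 2
    show ?thesis
    proof (rule shorter)
      show "shorter_neighbour u v"
        using 2 less.prems by (simp add: shorter_neighbour_def)
    qed (rule IH; linarith)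
  next
    case 3
    have "edge_defect v u = potential u - potential v"
    proof (rule shorter)
      show "shorter_neighbour v u"
        using 3 less.prems unimodular_pair_commute by (simp add: shorter_neighbour_def)
    qed (rule IH; linarith)
    then show ?thesis using edge_defect_commute[of u v] by simp
  qed
qed

subsection \<open>The rotation number as a sum over edges\<close>

lemma vec_angle_unimodular:
  assumes "unimodular_pair u v"
  shows "vec_angle (real_vec u) (real_vec v) = pi / 2 - arctan (real_of_int (idot u v))"
proof -
  define x where "x = real_of_int (idot u v)"
  have "norm (real_vec u) = sqrt (real_of_int (idot u u))" for u
    by (simp add: norm_vec_def L2_set_def sum_2 real_vec_def idot_def power2_eq_square)
  then have "norm (real_vec u) * norm (real_vec v) = sqrt (real_of_int (idot u u * idot v v))"
    by (simp add: real_sqrt_mult)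
  also have "\<dots> = sqrt (1 + x\<^sup>2)"
    by (simp add: unimodular_pair_norms(1)[OF assms] x_def)
  finally have "vec_angle (real_vec u) (real_vec v) = arccos (x / sqrt (1 + x\<^sup>2))"
    by (simp add: vec_angle_def x_def real_vec_def inner_vec_def sum_2 idot_def)
  also have "x / sqrt (1 + x\<^sup>2) = cos (pi / 2 - arctan x)"
    by (simp add: cos_diff sin_arctan)
  also have "arccos \<dots> = pi / 2 - arctan x"
    using arctan_bounded[of x] by (intro arccos_cos) auto
  finally show ?thesis by (simp add: x_def)
qed

lemma mu_eq:
  assumes "unimodular_pair u v" "unimodular_pair v w"
  shows "real_of_int (mu u v w) = - real_of_int (det2 u v * idot u v) / real_of_int (idot v v)
    - real_of_int (det2 v w * idot v w) / real_of_int (idot v v)"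
proof -
  have "det2 u v \<in> {-1, 1}" "det2 v w \<in> {-1, 1}"
    using assms by (auto simp: unimodular_pair_def)
  from theI'[OF mu_ex1[OF this]]
  have "det2 u v *s u + det2 v w *s w + mu u v w *s v = 0"
    by (simp add: mu_def)
  then have "idot (det2 u v *s u + det2 v w *s w + mu u v w *s v) v = 0"
    by (simp add: idot_def)
  then have "det2 u v * idot u v + det2 v w * idot v w + mu u v w * idot v v = 0"
    by (simp add: idot_def algebra_simps)
  then have "real_of_int (det2 u v * idot u v) + real_of_int (det2 v w * idot v w)
      + real_of_int (mu u v w) * real_of_int (idot v v) = 0"
    by (metis of_int_0 of_int_add of_int_mult)
  moreover have "real_of_int (idot v v) > 0"
    using unimodular_pair_norms[OF assms(1)] by simp
  ultimately show ?thesis by (simp add: field_simps)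
qed

lemma vertex_wrap:
  assumes "L \<noteq> []"
  shows "vertex L (Suc (length L)) = vertex L 1" "vertex L 0 = vertex L (length L)"
proof -
  define d where "d = length L"
  have "d > 0" using assms by (simp add: d_def)
  then have "(Suc d + d - 1) mod d = (1 + d - 1) mod d" "(0 + d - 1) mod d = (d + d - 1) mod d"
    using mod_add_self1[of d "d - 1"] by simp_all
  then show "vertex L (Suc (length L)) = vertex L 1" "vertex L 0 = vertex L (length L)"
    by (simp_all only: vertex_def flip: d_def)
qed

text \<open>Index 0 is included because \<open>mu\<close> at the first vertex refers to the edge
  that closes the cycle.\<close>

lemma cyclic_unimodular_pair:
  assumes "cyclic_unimodular L" "i \<le> length L"
  shows "unimodular_pair (vertex L i) (vertex L (Suc i))"
proof -
  have L: "L \<noteq> []" and last: "unimodular_pair (vertex L (length L)) (vertex L 1)"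
    using assms by (auto simp: cyclic_unimodular_def unimodular_pair_def)
  consider "i = 0" | "i = length L" | "i \<in> {1..<length L}"
    using assms(2) by fastforce
  then show ?thesis
  proof cases
    case 3
    then show ?thesis
      using assms by (fastforce simp: cyclic_unimodular_def unimodular_def unimodular_pair_def)
  qed (use last vertex_wrap[OF L] in simp_all)
qed

theorem theorem1:
  fixes L :: "(int^2) list"
  assumes "cyclic_unimodular L"
  shows "Rot L = 1 / 12 * real_of_int (mu_seq L) + 1 / 4 * real_of_int (nu_seq L)
    \<and> Rot L
      = 1 / 12 * (\<Sum>i=1..length L. real_of_int (mu (vertex L (i - 1)) (vertex L i) (vertex L (i + 1))))
        + 1 / 4 * (\<Sum>i=1..length L. real_of_int (nu (vertex L i) (vertex L (i + 1))))"
proof -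
  let ?I = "{1..length L}"
  define u where "u = vertex L"
  define e n :: "nat \<Rightarrow> real" where "e i = det2 (u i) (u (Suc i))" and "n i = idot (u i) (u i)" for i
  define x :: "nat \<Rightarrow> real" where "x i = idot (u i) (u (Suc i))" for i
  have "L \<noteq> []" using assms by (simp add: cyclic_unimodular_def)
  note wrap = vertex_wrap[OF this, folded u_def]
  note pair = cyclic_unimodular_pair[OF assms, folded u_def]
  have "real_of_int (mu_seq L)
      = (\<Sum>i\<in>?I. - (e (i - 1) * x (i - 1) / n i) - e i * x i / n i)"
    unfolding mu_seq_def of_int_sum
  proof (rule sum.cong)
    fix i assume i: "i \<in> ?I"
    then have "Suc (i - 1) = i" by simp
    then show "real_of_int (mu (vertex L (i - 1)) (vertex L i) (vertex L (i + 1)))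
        = - (e (i - 1) * x (i - 1) / n i) - e i * x i / n i"
      using mu_eq[of "u (i - 1)" "u i" "u (Suc i)"] pair[of "i - 1"] pair[of i] i
      by (simp add: e_def x_def n_def flip: u_def)
  qed simp
  \<comment> \<open>The half of \<open>mu\<close> belonging to the preceding edge is shifted to
    index \<open>i\<close>. The correction telescopes and vanishes because edge 0 is edge
    \<open>length L\<close>; \<open>Suc (i - 1)\<close> puts it into the form that
    \<open>sum_Suc_diff\<close> expects.\<close>
  also have "\<dots> = (\<Sum>i\<in>?I. - (e i * x i / n (Suc i)) - e i * x i / n i)
      + (\<Sum>i\<in>?I. e (Suc i - 1) * x (Suc i - 1) / n (Suc (Suc i - 1))
                - e (i - 1) * x (i - 1) / n (Suc (i - 1)))"
    unfolding sum.distrib[symmetric] by (rule sum.cong) auto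
  also have "(\<Sum>i\<in>?I. e (Suc i - 1) * x (Suc i - 1) / n (Suc (Suc i - 1))
                - e (i - 1) * x (i - 1) / n (Suc (i - 1))) = 0"
    using wrap by (subst sum_Suc_diff) (auto simp: e_def x_def n_def)
  finally have mu: "real_of_int (mu_seq L) = (\<Sum>i\<in>?I. - (e i * x i / n (Suc i)) - e i * x i / n i)"
    by simp
  have nu: "real_of_int (nu_seq L) = (\<Sum>i\<in>?I. e i)"
    by (simp add: nu_seq_def nu_def e_def u_def)
  have "12 * Rot L = (\<Sum>i\<in>?I. e i * (3 - 6 / pi * arctan (x i)))"
    unfolding Rot_def sum_distrib_left
  proof (rule sum.cong)
    fix i assume "i \<in> ?I"
    then have p: "unimodular_pair (u i) (u (Suc i))" by (intro pair) simp
    then have sgn: "sgn (det2 (u i) (u (Suc i))) = det2 (u i) (u (Suc i))"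
      by (auto simp: unimodular_pair_def)
    show "12 * (1 / (2 * pi) * (real_of_int (sgn (det2 (vertex L i) (vertex L (i + 1))))
          * vec_angle (real_vec (vertex L i)) (real_vec (vertex L (i + 1)))))
        = e i * (3 - 6 / pi * arctan (x i))"
      unfolding u_def[symmetric] Suc_eq_plus1[symmetric] sgn vec_angle_unimodular[OF p] e_def x_def
      by (simp add: field_simps)
  qed simp
  then have "12 * Rot L - real_of_int (mu_seq L) - 3 * real_of_int (nu_seq L)
      = (\<Sum>i\<in>?I. edge_defect (u i) (u (Suc i)))"
    unfolding mu nu sum_distrib_left
    by (simp add: sum_subtractf[symmetric] edge_defect_def e_def x_def n_def algebra_simps)
  also have "\<dots> = (\<Sum>i\<in>?I. potential (u (Suc i)) - potential (u i))"
    by (intro sum.cong edge_defect_eq_potential_diff pair) auto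
  also have "\<dots> = 0"
    using wrap by (subst sum_Suc_diff) auto
  finally have "Rot L = 1 / 12 * real_of_int (mu_seq L) + 1 / 4 * real_of_int (nu_seq L)"
    by simp
  then show ?thesis by (simp add: mu_seq_def nu_seq_def)
qed

end
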